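(* Let $g:\mathbb{R}^{10}\times\mathbb{R}^{10}\to\mathbb{R}^{16}$ be the normed bilinear map of a $[10,10,16]_{\mathbb{Z}}$ formula. Then $g$ is not a restriction of any normed bilinear map of size $[h,m,m]$; that is, for all positive integers $h,m$ and every normed bilinear map $F:\mathbb{R}^h\times\mathbb{R}^m\to\mathbb{R}^m$, $g$ is not a restriction of $F$.
   Context: All norms are Euclidean. For positive integers $r,s,n$, a normed bilinear map of size $[r,s,n]$ (equivalently, an $[r,s,n]_{\mathbb{R}}$ formula) is an $\mathbb{R}$-bilinear map $f:\mathbb{R}^r\times\mathbb{R}^s\to\mathbb{R}^n$ with $|f(x,y)|=|x|\,|y|$ for all $x\in\mathbb{R}^r$, $y\in\mathbb{R}^s$. Writing $f=(z_1,\dots,z_n)$ with each $z_k(x,y)$ a bilinear form in the coordinates $x_1,\dots,x_r$ and $y_1,\dots,y_s$, this means $(x_1^2+\cdots+x_r^2)(y_1^2+\cdots+y_s^2)=z_1^2+\cdots+z_n^2$. An $[r,s,n]_{\mathbb{Z}}$ formula is such a formula in which every bilinear form $z_k$ has integer coefficients (with respect to the standard coordinates). Restriction: Let $F:\mathbb{R}^h\times\mathbb{R}^m\to\mathbb{R}^m$ be a normed bilinear map. A normed bilinear map $g:\mathbb{R}^r\times\mathbb{R}^s\to\mathbb{R}^n$ is a restriction of $F$ if there are linear subspaces $X\subseteq\mathbb{R}^h$, $Y\subseteq\mathbb{R}^m$, $Z\subseteq\mathbb{R}^m$ of dimensions $r,s,n$ respectively with $F(X\times Y)\subseteq Z$,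 and linear isometries (onto) $\alpha:\mathbb{R}^r\to X$, $\beta:\mathbb{R}^s\to Y$, $\gamma:\mathbb{R}^n\to Z$ such that $\gamma(g(x,y))=F(\alpha(x),\beta(y))$ for all $x\in\mathbb{R}^r$, $y\in\mathbb{R}^s$. *)

theory Defs
  imports "HOL-Analysis.Analysis"
begin

definition normed_bilinear ::
  "(real ^ 'r::finite \<Rightarrow> real ^ 's::finite \<Rightarrow> real ^ 'n::finite) \<Rightarrow> bool" where
  "normed_bilinear f \<longleftrightarrow> bilinear f \<and> (\<forall>x y. norm (f x y) = norm x * norm y)"

definition integer_coeffs ::
  "(real ^ 'r::finite \<Rightarrow> real ^ 's::finite \<Rightarrow> real ^ 'n::finite) \<Rightarrow> bool" where
  "integer_coeffs f \<longleftrightarrow>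
     (\<exists>c :: 'n \<Rightarrow> 'r \<Rightarrow> 's \<Rightarrow> int. \<forall>x y k.
        f x y $ k = (\<Sum>i\<in>UNIV. \<Sum>j\<in>UNIV. of_int (c k i j) * x $ i * y $ j))"

definition integer_formula ::
  "(real ^ 'r::finite \<Rightarrow> real ^ 's::finite \<Rightarrow> real ^ 'n::finite) \<Rightarrow> bool" where
  "integer_formula f \<longleftrightarrow> normed_bilinear f \<and> integer_coeffs f"

definition linear_isometry_onto ::
  "(real ^ 'a::finite \<Rightarrow> real ^ 'b::finite) \<Rightarrow> (real ^ 'b) set \<Rightarrow> bool" where
  "linear_isometry_onto \<phi> X \<longleftrightarrow> linear \<phi> \<and> (\<forall>x. norm (\<phi> x) = norm x) \<and> range \<phi> = X"

text \<open>That \<open>g\<close> and \<open>F\<close> are themselves normed bilinear maps is not part of the following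
  definition; it has to be assumed separately.\<close>

definition is_restriction ::
  "(real ^ 'r::finite \<Rightarrow> real ^ 's::finite \<Rightarrow> real ^ 'n::finite) \<Rightarrow>
   (real ^ 'h::finite \<Rightarrow> real ^ 'm::finite \<Rightarrow> real ^ 'm) \<Rightarrow> bool" where
  "is_restriction g F \<longleftrightarrow>
     (\<exists>X Y Z \<alpha> \<beta> \<gamma>.
        subspace X \<and> dim X = CARD('r) \<and>
        subspace Y \<and> dim Y = CARD('s) \<and>
        subspace Z \<and> dim Z = CARD('n) \<and>
        (\<forall>x\<in>X. \<forall>y\<in>Y. F x y \<in> Z) \<and>
        linear_isometry_onto \<alpha> X \<and> linear_isometry_onto \<beta> Y \<and> linear_isometry_onto \<gamma> Z \<and>
        (\<forall>x y. \<gamma> (g x y) = F (\<alpha> x) (\<beta> y)))"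

end

theory Submission
  imports Defs
begin

text \<open>
  Integrality forces \<open>g e\<^sub>i e\<^sub>j = \<plusminus> e\<^bsub>c i j\<^esub>\<close>, where \<open>c\<close> is a colouring of the
  \<open>10 \<times> 10\<close> grid by 16 colours. If \<open>g\<close> is a restriction of \<open>F\<close>, let \<open>A\<^sub>i\<close> be the matrix of
  \<open>F (\<alpha> e\<^sub>i)\<close>. As it is square, both \<open>A\<^sub>i\<^sup>T A\<^sub>k\<close> and \<open>A\<^sub>i A\<^sub>k\<^sup>T\<close> anticommute in \<open>i, k\<close>,
  so \<open>(u, v) \<mapsto> (A\<^sub>i\<^sup>T v, A\<^sub>i u)\<close> are ten anticommuting involutions \<open>a\<^sub>i\<close>.

  Call a 4-set of rows a tetrad if the product of its \<open>a\<^sub>i\<close> fixes the vectors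
  \<open>w\<^sub>j = (\<beta> e\<^sub>j, 0)\<close> up to sign. The products of two tetrads commute or anticommute according
  to the parity of the intersection, and a common eigenvector with nonzero eigenvalues excludes
  the latter, so any two tetrads meet in an even number of rows. Two columns \<open>j \<noteq> l\<close> share at least 4 colours, and
  \<open>c i j = c k l\<close> defines a matching of the rows involved, any two edges of which form a
  tetrad; this also puts every two rows in a common tetrad. The parity condition on ten points
  then shows that a matching with more than 4 rows is perfect, and that each column belongs to
  at most one perfect matching.

  Hence a column shares at most \<open>10 + 10 + 8 \<cdot> 4 = 52\<close> colours with all columns, itself
  included, while by Cauchy-Schwarz the number of colours shared, summed over all ordered pairs
  of columns, is at least \<open>100\<^sup>2 / 16 = 625 > 520\<close>.
\<close>

section \<open>Matchings on ten points and 4-sets with even intersections\<close>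

text \<open>A member of \<open>Q\<close> joining \<open>M\<close> to an outside point
  \<open>h\<close> must contain a point of every pair \<open>{v, m v}\<close>; by size it has three
  points in \<open>M\<close> and only \<open>h\<close> outside. A member through \<open>h\<close>
  and a second outside point then meets it in \<open>h\<close> alone.\<close>

lemma matching_cover:
  fixes m :: "'r::finite \<Rightarrow> 'r" and Q :: "'r set set"
  assumes ten: "CARD('r) = 10"
    and four: "\<And>T. T \<in> Q \<Longrightarrow> card T = 4"
    and even: "\<And>T T'. T \<in> Q \<Longrightarrow> T' \<in> Q \<Longrightarrow> even (card (T \<inter> T'))"
    and cover: "\<And>u h. u \<noteq> h \<Longrightarrow> \<exists>T\<in>Q. u \<in> T \<and> h \<in> T"
    and inv: "\<And>u. u \<in> M \<Longrightarrow> m u \<in> M \<and> m u \<noteq> u \<and> m (m u) = u"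
    and pairs: "\<And>u v. u \<in> M \<Longrightarrow> v \<in> M \<Longrightarrow> v \<notin> {u, m u} \<Longrightarrow> {u, m u, v, m v} \<in> Q"
    and closed: "\<And>u h x. u \<in> M \<Longrightarrow> {u, m u, h, x} \<in> Q \<Longrightarrow> h \<in> M"
    and large: "card M > 4"
  shows "M = UNIV"
proof (rule ccontr)
  have odd_pair: "v \<in> T \<or> m v \<in> T"
    if "T \<in> Q" "u \<in> M" "v \<in> M" "u \<in> T" "m u \<notin> T" for T u v
  proof (rule ccontr)
    assume neg: "\<not> ?thesis"
    have d: "v \<notin> {u, m u}" using neg that inv[of u] by auto
    have "{u, m u, v, m v} \<inter> T = {u}" using neg that by auto
    thus False using even[OF pairs[OF that(2,3) d] that(1)] by simp
  qed
  have even_pair: "m v \<in> T"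
    if "T \<in> Q" "u \<in> M" "v \<in> M" "u \<in> T" "m u \<in> T" "v \<in> T" for T u v
  proof (cases "v \<in> {u, m u}")
    case False
    show ?thesis
    proof (rule ccontr)
      assume neg: "m v \<notin> T"
      have "{u, m u, v, m v} \<inter> T = {u, m u, v}" using neg that by auto
      moreover have "card {u, m u, v} = 3" using False inv[OF that(2)] by auto
      ultimately show False using even[OF pairs[OF that(2,3) False] that(1)] by simp
    qed
  next
    case True
    thus ?thesis using that(4,5) inv[OF that(2)] by fastforce
  qed
  \<comment> \<open>Otherwise the fourth point completes \<open>{u, m u, h, x}\<close>, and
    \<open>closed\<close> puts \<open>h\<close> into \<open>M\<close>.\<close>
  have mixed: "m u \<notin> T" if T: "T \<in> Q" and u: "u \<in> M" "u \<in> T" and h: "h \<notin> M" "h \<in> T" for T u h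
  proof
    assume mu: "m u \<in> T"
    have "u \<noteq> h" "m u \<noteq> h" using inv[OF u(1)] u h by auto
    hence "card {u, m u, h} = 3" using inv[OF u(1)] by auto
    hence "card (T - {u, m u, h}) = 1" using four[OF T] u h mu by (subst card_Diff_subset) auto
    then obtain x where "T - {u, m u, h} = {x}" by (auto simp: card_1_singleton_iff)
    hence "T = {u, m u, h, x}" using u h mu by auto
    thus False using closed[OF u(1), of h x] T h by auto
  qed
  have half: "card M \<le> 2 * card (T \<inter> M)"
    if T: "T \<in> Q" and u: "u \<in> M" "u \<in> T" and h: "h \<notin> M" "h \<in> T" for T u h
  proof -
    have "M \<subseteq> (T \<inter> M) \<union> m ` (T \<inter> M)"
    proof
      fix v assume v: "v \<in> M"
      have "v \<in> T \<or> m v \<in> T" using odd_pair[OF T u(1) v u(2) mixed[OF T u h]] .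
      thus "v \<in> (T \<inter> M) \<union> m ` (T \<inter> M)" using inv[OF v] v by (metis IntI UnCI imageI)
    qed
    hence "card M \<le> card ((T \<inter> M) \<union> m ` (T \<inter> M))" by (intro card_mono) auto
    also have "\<dots> \<le> card (T \<inter> M) + card (m ` (T \<inter> M))" by (rule card_Un_le)
    also have "card (m ` (T \<inter> M)) \<le> card (T \<inter> M)" by (rule card_image_le) auto
    finally show ?thesis by simp
  qed
  have single: "T - M = {h} \<and> card M \<le> 6"
    if T: "T \<in> Q" and u: "u \<in> M" "u \<in> T" and h: "h \<notin> M" "h \<in> T" for T u h
  proof -
    have "card (T \<inter> M) + card (T - M) = 4"
      using four[OF T] by (metis card_Int_Diff finite)
    moreover have "card (T - M) \<ge> card {h}" using h by (intro card_mono) auto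
    moreover have "card M \<le> 2 * card (T \<inter> M)" using half[OF that] .
    ultimately have c: "card (T - M) = 1" "card (T \<inter> M) = 3" using large by auto
    from c(1) obtain y where "T - M = {y}" by (auto simp: card_1_singleton_iff)
    with h have "T - M = {h}" by auto
    thus ?thesis using c half[OF that] by simp
  qed
  assume "M \<noteq> UNIV"
  then obtain h where h: "h \<notin> M" by auto
  obtain u where u: "u \<in> M" using large by (metis card.empty equals0I not_less_zero)
  obtain T where T: "T \<in> Q" "u \<in> T" "h \<in> T" using cover[of u h] u h by auto
  have s: "T - M = {h}" "card M \<le> 6" using single[OF T(1) u T(2) h T(3)] by auto
  \<comment> \<open>With at most 6 of the ten points in \<open>M\<close>, a second outside point
    exists.\<close>
  have "card (- M) \<ge> 4" using s(2) ten by (simp add: Compl_eq_Diff_UNIV card_Diff_subset)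
  hence "\<not> - M \<subseteq> {h}" using card_mono[of "{h}" "- M"] by auto
  then obtain h' where h': "h' \<notin> M" "h' \<noteq> h" by auto
  obtain T' where T': "T' \<in> Q" "h \<in> T'" "h' \<in> T'" using cover[of h h'] h' by auto
  have "T' \<inter> M = {}"
  proof (rule ccontr)
    assume "T' \<inter> M \<noteq> {}"
    then obtain v where "v \<in> M" "v \<in> T'" by auto
    from single[OF T'(1) this h T'(2)] show False using h' T' by auto
  qed
  hence "T \<inter> T' = {h}" using s(1) T T' by auto
  thus False using even[OF T(1) T'(1)] by simp
qed

text \<open>If the matchings differ at \<open>u\<close>, a member of \<open>Q\<close> built from two
  pairs of \<open>m'\<close> contains \<open>u\<close> but not \<open>m u\<close> and misses a whole
  pair of \<open>m\<close>. It meets the union of that pair and \<open>{u, m u}\<close> in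
  \<open>u\<close> alone.\<close>

lemma matching_unique:
  fixes m m' :: "'r::finite \<Rightarrow> 'r" and Q :: "'r set set"
  assumes ten: "CARD('r) = 10"
    and four: "\<And>T. T \<in> Q \<Longrightarrow> card T = 4"
    and even: "\<And>T T'. T \<in> Q \<Longrightarrow> T' \<in> Q \<Longrightarrow> even (card (T \<inter> T'))"
    and inv: "\<And>u. m u \<noteq> u \<and> m (m u) = u" "\<And>u. m' u \<noteq> u \<and> m' (m' u) = u"
    and pairs: "\<And>u v. v \<notin> {u, m u} \<Longrightarrow> {u, m u, v, m v} \<in> Q"
      "\<And>u v. v \<notin> {u, m' u} \<Longrightarrow> {u, m' u, v, m' v} \<in> Q"
  shows "m u = m' u"
proof (rule ccontr)
  assume ne: "m u \<noteq> m' u"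
  \<comment> \<open>Excluding \<open>m' (m u)\<close> keeps \<open>m u\<close> different from
    \<open>m' x\<close>.\<close>
  have "card {u, m' u, m u, m' (m u)} \<le> 4"
    by (simp add: card_insert_if)
  hence "{u, m' u, m u, m' (m u)} \<noteq> UNIV" using ten by auto
  then obtain x where x: "x \<notin> {u, m' u, m u, m' (m u)}" by auto
  define T where "T = {u, m' u, x, m' x}"
  have T: "T \<in> Q" unfolding T_def using x by (intro pairs) auto
  have mu: "m u \<notin> T" unfolding T_def using x ne inv by (metis empty_iff insert_iff)
  \<comment> \<open>At least two of the ten points remain, so some pair of \<open>m\<close> avoids
    \<open>T\<close>.\<close>
  have "card (T \<union> m ` T) \<le> 8"
    using card_Un_le[of T "m ` T"] card_image_le[of T m] four[OF T] by simp
  hence "T \<union> m ` T \<noteq> UNIV" using ten by auto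
  then obtain v where v: "v \<notin> T" "v \<notin> m ` T" by auto
  hence mv: "m v \<notin> T" using inv(1)[of v] by (metis imageI)
  have uT: "u \<in> T" by (simp add: T_def)
  have "v \<notin> {u, m u}" using v uT by auto
  hence D: "{u, m u, v, m v} \<in> Q" by (rule pairs)
  have "{u, m u, v, m v} \<inter> T = {u}" using v mv mu uT by auto
  thus False using even[OF D T] by simp
qed

text \<open>Signs are irrelevant for the colouring, so vectors are compared up to sign.\<close>

definition sim :: "'v::real_vector \<Rightarrow> 'v \<Rightarrow> bool"
  where "sim u v \<longleftrightarrow> u = v \<or> u = - v"

lemma sim_refl [simp]: "sim u u"
  by (simp add: sim_def)

lemma sim_sym: "sim u v \<Longrightarrow> sim v u"
  by (auto simp: sim_def)

lemma sim_trans [trans]: "sim u v \<Longrightarrow> sim v x \<Longrightarrow> sim u x"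
  by (auto simp: sim_def)

lemma eq_minus_self_iff: "v = - v \<longleftrightarrow> v = 0" for v :: "'v::real_vector"
proof
  assume "v = - v"
  hence "2 *\<^sub>R v = 0" by (metis add.left_inverse scaleR_2)
  thus "v = 0" by simp
qed simp

lemma sim_linear: "linear f \<Longrightarrow> sim u v \<Longrightarrow> sim (f u) (f v)"
  by (auto simp: sim_def linear_neg)

section \<open>Clifford relations and products of generators\<close>

locale anticommuting_involutions =
  fixes a :: "'r::finite \<Rightarrow> 'v::real_vector \<Rightarrow> 'v"
  assumes lin: "linear (a i)"
    and sq [simp]: "a i (a i v) = v"
    and anti: "i \<noteq> k \<Longrightarrow> a i (a k v) = - a k (a i v)"
begin

lemma sim_a: "sim u v \<Longrightarrow> sim (a i u) (a i v)"
  by (rule sim_linear[OF lin])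

lemma sim_swap: "sim (a i (a k v)) (a k (a i v))"
  using anti[of i k v] by (cases "i = k") (auto simp: sim_def)

lemma sim_move: "sim (a i u) v \<longleftrightarrow> sim u (a i v)"
  using sim_a[of "a i u" v i] sim_a[of u "a i v" i] by auto

abbreviation word :: "'r list \<Rightarrow> 'v \<Rightarrow> 'v"
  where "word L \<equiv> foldr a L"

lemma linear_word: "linear (word L)"
proof (induction L)
  case Nil
  show ?case using linear_id by (simp add: id_def)
next
  case (Cons x L)
  show ?case using linear_compose[OF Cons lin[of x]] by (simp add: o_def)
qed

lemma sim_word_a: "sim (word L (a i v)) (a i (word L v))"
proof (induction L)
  case (Cons x L)
  from sim_trans[OF sim_a[OF this] sim_swap] show ?case by simp
qed simp

lemma sim_word_perm: "mset L = mset L' \<Longrightarrow> sim (word L v) (word L' v)"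
proof (induction L arbitrary: L')
  case (Cons x L)
  then have "x \<in> set L'" by (metis list.set_intros(1) mset_eq_setD)
  then obtain ys zs where L': "L' = ys @ x # zs" by (meson split_list)
  have "sim (word L v) (word (ys @ zs) v)" using Cons.prems L' by (intro Cons.IH) simp
  hence "sim (word (x # L) v) (a x (word ys (word zs v)))" using sim_a by simp
  also have "sim \<dots> (word ys (a x (word zs v)))" by (rule sim_sym[OF sim_word_a])
  finally show ?case by (simp add: L')
qed simp

text \<open>Every letter other than \<open>i\<close> contributes one sign. The exponent adds the
  indicator instead of subtracting it, which leaves the parity unchanged.\<close>

lemma a_word:
  assumes "distinct L"
  shows "a i (word L v) = (-1) ^ (length L + of_bool (i \<in> set L)) *\<^sub>R word L (a i v)"
  using assms
proof (induction L)
  case (Cons x L)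
  show ?case
  proof (cases "i = x")
    case True
    have "word L (a i v) = (-1) ^ length L *\<^sub>R a i (word L v)" using Cons True by simp
    thus ?thesis using True by (simp add: linear_cmul[OF lin])
  next
    case False
    then show ?thesis using Cons anti[OF False] by (simp add: linear_cmul[OF lin])
  qed
qed simp

lemma word_word:
  assumes "distinct L" "distinct L'"
  shows "word L (word L' v) =
    (-1) ^ (length L * length L' + card (set L \<inter> set L')) *\<^sub>R word L' (word L v)"
  using assms(1)
proof (induction L)
  case (Cons x L)
  have c: "card (set (x # L) \<inter> set L') = of_bool (x \<in> set L') + card (set L \<inter> set L')"
    using Cons.prems by simp
  have "word (x # L) (word L' v) =
      (-1) ^ (length L * length L' + card (set L \<inter> set L')) *\<^sub>R a x (word L' (word L v))"
    using Cons by (simp add: linear_cmul[OF lin])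
  also have "\<dots> = (-1) ^ (length L * length L' + card (set L \<inter> set L')) *\<^sub>R
      (-1) ^ (length L' + of_bool (x \<in> set L')) *\<^sub>R word L' (word (x # L) v)"
    by (simp add: a_word[OF assms(2)])
  also have "\<dots> = (-1) ^ (length (x # L) * length L' + card (set (x # L) \<inter> set L')) *\<^sub>R
      word L' (word (x # L) v)"
    unfolding c by (simp add: power_add algebra_simps)
  finally show ?case .
qed simp

text \<open>Two words commute on a common eigenvector; with \<open>L\<close> of even length, an odd
  intersection would make them anticommute there, forcing \<open>v = 0\<close>.\<close>

lemma word_stabilizer_even:
  assumes L: "distinct L" "distinct L'" "even (length L)"
    and stab: "sim (word L v) v" "sim (word L' v) v" and "v \<noteq> 0"
  shows "even (card (set L \<inter> set L'))"
proof (rule ccontr)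
  assume "odd (card (set L \<inter> set L'))"
  hence "word L (word L' v) = - word L' (word L v)"
    using word_word[OF L(1,2), of v] L(3) by simp
  moreover have "word L (word L' v) = word L' (word L v)"
    using stab by (auto simp: sim_def linear_neg[OF linear_word])
  moreover have "sim (word L (word L' v)) v"
    using sim_trans[OF sim_linear[OF linear_word stab(2)] stab(1)] .
  ultimately show False using \<open>v \<noteq> 0\<close>
    by (auto simp: sim_def eq_minus_self_iff)
qed

end

section \<open>Coloured grid, matchings of rows and tetrads\<close>

locale colored_action = anticommuting_involutions a
  for a :: "'r::finite \<Rightarrow> 'v::real_vector \<Rightarrow> 'v" +
  fixes w :: "'s::finite \<Rightarrow> 'v" and c :: "'r \<Rightarrow> 's \<Rightarrow> 'k::finite"
  assumes w_nonzero: "w j \<noteq> 0"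
    and w_inj: "sim (w j) (w l) \<Longrightarrow> j = l"
    and color: "c i j = c k l \<longleftrightarrow> sim (a i (w j)) (a k (w l))"
    and rows: "CARD('r) = 10" and cols: "CARD('s) = 10" and colors: "CARD('k) = 16"
begin

lemma color_iff: "c i j = c k l \<longleftrightarrow> sim (w l) (a k (a i (w j)))"
  by (metis color sim_move sim_sym)

lemma row_inj: "c i j = c i l \<Longrightarrow> j = l"
  by (rule w_inj, rule sim_sym) (simp add: color_iff)

text \<open>Equal colours make \<open>a i\<close> and \<open>a k\<close> commute on
  \<open>w j\<close>, while for \<open>i \<noteq> k\<close> they anticommute.\<close>

lemma col_inj: "c i j = c k j \<Longrightarrow> i = k"
proof (rule ccontr)
  assume *: "c i j = c k j" "i \<noteq> k"
  have "a k (w j) \<noteq> 0" using w_nonzero[of j] sq[of k "w j"] linear_0[OF lin] by metis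
  have "a i (w j) = a k (w j) \<or> a i (w j) = - a k (w j)" using * by (simp add: color sim_def)
  hence "a k (a i (w j)) = a i (a k (w j))"
    using linear_neg[OF lin] by (metis minus_minus sq)
  hence "a i (a k (w j)) = 0" using anti[OF *(2), of "w j"] by (simp add: eq_minus_self_iff)
  hence "a k (w j) = 0" using sq[of i "a k (w j)"] linear_0[OF lin] by metis
  with \<open>a k (w j) \<noteq> 0\<close> show False by contradiction
qed

text \<open>The product carrying column \<open>j\<close> to column \<open>l\<close> may be reversed
  up to sign, so a repeated colour on one diagonal of a 2 by 2 subgrid forces one on the
  other.\<close>

lemma intercalate:
  assumes "c i j = c k l"
  shows "c i l = c k j"
proof -
  have "sim (a i (w l)) (a i (a k (a i (w j))))"
    using assms by (simp add: color_iff sim_a)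
  also have "sim \<dots> (a i (a i (a k (w j))))" by (intro sim_a sim_swap)
  finally show ?thesis by (simp add: color)
qed

definition common :: "'s \<Rightarrow> 's \<Rightarrow> 'r set"
  where "common j l = {i. \<exists>k. c i j = c k l}"

text \<open>By \<open>col_inj\<close> the row is unique; the value is meaningful only on
  \<open>common j l\<close>.\<close>

definition mate :: "'s \<Rightarrow> 's \<Rightarrow> 'r \<Rightarrow> 'r"
  where "mate j l i = (THE k. c i j = c k l)"

lemma mate_eq: "c i j = c k l \<Longrightarrow> mate j l i = k"
  unfolding mate_def by (rule the_equality) (auto dest: col_inj sym)

lemma mate: "i \<in> common j l \<Longrightarrow> c i j = c (mate j l i) l"
  unfolding common_def using mate_eq by blast

lemma mate_involution:
  assumes "i \<in> common j l" "j \<noteq> l"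
  shows "mate j l i \<in> common j l \<and> mate j l i \<noteq> i \<and> mate j l (mate j l i) = i"
proof -
  have e: "c (mate j l i) j = c i l" using intercalate[OF mate[OF assms(1)]] by simp
  have "mate j l i \<noteq> i" using mate[OF assms(1)] row_inj[of i j l] assms(2) by auto
  thus ?thesis using e mate_eq[OF e] by (auto simp: common_def)
qed

lemma card_common: "card (common j l) = card (range (\<lambda>i. c i j) \<inter> range (\<lambda>i. c i l))"
proof -
  have "(\<lambda>i. c i j) ` common j l = range (\<lambda>i. c i j) \<inter> range (\<lambda>i. c i l)"
    by (auto simp: common_def)
  moreover have "inj_on (\<lambda>i. c i j) (common j l)" by (auto intro: inj_onI dest: col_inj)
  ultimately show ?thesis by (metis card_image)
qed

lemma card_overlap:
  fixes A B :: "'k set"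
  assumes "card A = 10" "card B = 10"
  shows "card (A \<inter> B) \<ge> 4"
proof -
  have "card (A \<union> B) \<le> 16" using card_mono[of UNIV "A \<union> B"] colors by simp
  thus ?thesis using card_Un_Int[of A B] assms by simp
qed

lemma card_column: "card (range (\<lambda>i. c i j)) = 10"
  using card_image[of "\<lambda>i. c i j" UNIV] rows by (auto intro: injI dest: col_inj)

lemma card_row: "card (range (c i)) = 10"
  using card_image[of "c i" UNIV] cols by (auto intro: injI dest: row_inj)

lemma card_common_ge: "card (common j l) \<ge> 4"
  unfolding card_common by (intro card_overlap card_column)

text \<open>Up to sign the order of factors is irrelevant, so quantifying over all orderings only
  turns a condition on words into one on sets.\<close>

definition tetrads :: "'r set set"
  where "tetrads = {T. card T = 4 \<and>
    (\<forall>L j. distinct L \<longrightarrow> set L = T \<longrightarrow> sim (word L (w j)) (w j))}"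

lemma card_tetrad: "T \<in> tetrads \<Longrightarrow> card T = 4"
  by (simp add: tetrads_def)

lemma even_tetrads:
  assumes "T \<in> tetrads" "T' \<in> tetrads"
  shows "even (card (T \<inter> T'))"
proof -
  obtain L L' where L: "distinct L" "set L = T" "distinct L'" "set L' = T'"
    by (meson finite finite_distinct_list)
  have "length L = 4" using L card_tetrad[OF assms(1)] by (metis distinct_card)
  \<comment> \<open>Any column gives a common eigenvector; \<open>undefined\<close> is an arbitrary
    choice.\<close>
  thus ?thesis
    using word_stabilizer_even[OF L(1,3), of "w undefined"] L assms w_nonzero
    by (auto simp: tetrads_def)
qed

text \<open>Both \<open>a k a i\<close> and \<open>a q a p\<close> carry \<open>w j\<close> to
  \<open>w l\<close> up to sign, so the fourfold product fixes \<open>w j\<close> up to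
  sign.\<close>

lemma tetradI:
  assumes "c i j = c k l" "c p j = c q l" and card: "card {i, k, p, q} = 4"
  shows "{i, k, p, q} \<in> tetrads"
  unfolding tetrads_def
proof (intro CollectI conjI allI impI card)
  fix L j' assume L: "distinct L" "set L = {i, k, p, q}"
  have d: "distinct [p, q, k, i]" using card by (auto simp: card_insert_if split: if_splits)
  have "mset L = mset [p, q, k, i]"
    using L d by (subst set_eq_iff_mset_eq_distinct[symmetric]) auto
  hence perm: "sim (word L v) (word [p, q, k, i] v)" for v by (rule sim_word_perm)
  have "sim (w l) (a k (a i (w j)))" "sim (w l) (a q (a p (w j)))"
    using assms by (auto simp: color_iff)
  hence "sim (a k (a i (w j))) (a q (a p (w j)))" using sim_sym sim_trans by blast
  hence "sim (word [p, q, k, i] (w j)) (w j)" by (simp add: sim_move)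
  hence stab: "sim (word L (w j)) (w j)" using perm sim_trans by blast
  txt \<open>Any column is reached from column \<open>j\<close> by some \<open>a\<^sub>y a\<^sub>x\<close>, which commutes with the word up to sign.\<close>
  have "common j j' \<noteq> {}" using card_common_ge[of j j'] by auto
  then obtain x y where "c x j = c y j'" by (auto simp: common_def)
  hence xy: "sim (w j') (a y (a x (w j)))" by (simp add: color_iff)
  have "sim (word L (w j')) (word L (a y (a x (w j))))"
    by (rule sim_linear[OF linear_word xy])
  also have "sim \<dots> (a y (word L (a x (w j))))" by (rule sim_word_a)
  also have "sim \<dots> (a y (a x (word L (w j))))" by (intro sim_a sim_word_a)
  also have "sim \<dots> (a y (a x (w j)))" by (intro sim_a stab)
  also have "sim \<dots> (w j')" by (rule sim_sym[OF xy])
  finally show "sim (word L (w j')) (w j')" .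
qed

text \<open>The converse exchange: it supplies the hypothesis \<open>closed\<close> of
  \<open>matching_cover\<close>.\<close>

lemma tetradD:
  assumes T: "{i, k, p, q} \<in> tetrads" and "c i j = c k l"
  shows "c p j = c q l"
proof -
  have d: "distinct [p, q, k, i]"
    using card_tetrad[OF T] by (auto simp: card_insert_if split: if_splits)
  have "set [p, q, k, i] = {i, k, p, q}" by auto
  with T d have "sim (word [p, q, k, i] (w j)) (w j)"
    unfolding tetrads_def by blast
  hence "sim (a k (a i (w j))) (a q (a p (w j)))" by (simp add: sim_move)
  thus ?thesis using assms(2) sim_trans by (auto simp: color_iff)
qed

lemma mate_pairs:
  assumes "j \<noteq> l" "u \<in> common j l" "v \<in> common j l" "v \<notin> {u, mate j l u}"
  shows "{u, mate j l u, v, mate j l v} \<in> tetrads"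
proof (rule tetradI)
  show "c u j = c (mate j l u) l" "c v j = c (mate j l v) l" using mate assms by auto
  show "card {u, mate j l u, v, mate j l v} = 4"
    using mate_involution[OF assms(2,1)] mate_involution[OF assms(3,1)] assms(4)
    by (auto simp: card_insert_if)
qed

text \<open>Two rows share a colour, hence form an edge of some matching; that matching has a second
  edge.\<close>

lemma tetrad_cover:
  assumes "i \<noteq> k"
  shows "\<exists>T\<in>tetrads. i \<in> T \<and> k \<in> T"
proof -
  have "range (c i) \<inter> range (c k) \<noteq> {}"
    using card_overlap[OF card_row card_row, of i k] by auto
  then obtain j l where e: "c i j = c k l" by auto
  have jl: "j \<noteq> l" using col_inj e assms by auto
  have i: "i \<in> common j l" "mate j l i = k" using e mate_eq by (auto simp: common_def)
  have "\<not> common j l \<subseteq> {i, k}"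
    using card_common_ge[of j l] card_mono[of "{i, k}" "common j l"] assms by auto
  then obtain p where "p \<in> common j l" "p \<notin> {i, k}" by auto
  thus ?thesis using mate_pairs[OF jl i(1), of p] i by auto
qed

lemma large_common:
  assumes "j \<noteq> l" "card (common j l) > 4"
  shows "common j l = UNIV"
proof (rule matching_cover[where m = "mate j l" and Q = tetrads])
  show "u \<in> common j l \<Longrightarrow> mate j l u \<in> common j l \<and> mate j l u \<noteq> u \<and> mate j l (mate j l u) = u"
    for u using mate_involution assms(1) by blast
  show "u \<in> common j l \<Longrightarrow> v \<in> common j l \<Longrightarrow> v \<notin> {u, mate j l u} \<Longrightarrow>
      {u, mate j l u, v, mate j l v} \<in> tetrads" for u v
    by (rule mate_pairs[OF assms(1)])
  show "h \<in> common j l" if "u \<in> common j l" "{u, mate j l u, h, x} \<in> tetrads" for u h x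
    using tetradD[OF that(2) mate[OF that(1)]] by (auto simp: common_def)
qed (fact rows card_tetrad even_tetrads tetrad_cover assms)+

lemma large_common_unique:
  assumes "j \<noteq> l" "card (common j l) > 4" "j \<noteq> l'" "card (common j l') > 4"
  shows "l = l'"
proof -
  have U: "common j l = UNIV" "common j l' = UNIV" using large_common assms by auto
  have eq: "mate j l u = mate j l' u" for u
    by (rule matching_unique[where Q = tetrads])
      (use U mate_involution[of _ j l] mate_involution[of _ j l'] mate_pairs[of j l]
        mate_pairs[of j l'] assms even_tetrads card_tetrad rows in auto)
  \<comment> \<open>Equal mates put one colour of column \<open>j\<close> into columns
    \<open>l\<close> and \<open>l'\<close> in the same row.\<close>
  have "c (mate j l undefined) l = c (mate j l undefined) l'"
    using mate[of undefined j l] mate[of undefined j l'] U eq by auto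
  thus ?thesis by (rule row_inj)
qed

section \<open>Counting shared colours\<close>

lemma sum_common_le: "(\<Sum>l\<in>UNIV. card (common j l)) \<le> 52"
proof -
  have ten: "card (common j l) \<le> 10" for l
    using card_mono[of UNIV "common j l"] rows by simp
  \<comment> \<open>\<open>l0\<close> is the exceptional column if there is one, and arbitrary
    otherwise.\<close>
  obtain l0 where l0: "\<And>l. l \<noteq> j \<Longrightarrow> l \<noteq> l0 \<Longrightarrow> card (common j l) \<le> 4"
    using large_common_unique[of j] by (metis not_le_imp_less)
  have "(\<Sum>l\<in>UNIV. card (common j l)) \<le> (\<Sum>l\<in>UNIV. 4 + (if l = j then 6 else 0) + (if l = l0 then 6 else 0))"
  proof (rule sum_mono)
    fix l
    show "card (common j l) \<le> 4 + (if l = j then 6 else 0) + (if l = l0 then 6 else 0)"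
      using ten[of l] l0[of l] by auto
  qed
  also have "\<dots> = 52" by (simp add: sum.distrib cols)
  finally show ?thesis .
qed

lemma contradiction: False
proof -
  define d where "d x = card {j. x \<in> range (\<lambda>i. c i j)}" for x
  have count: "card {x. P x} = (\<Sum>x\<in>UNIV. of_bool (P x))" for P :: "'t::finite \<Rightarrow> bool"
    by (simp add: of_bool_def sum.If_cases)
  have d: "d x = (\<Sum>j\<in>UNIV. of_bool (x \<in> range (\<lambda>i. c i j)))" for x
    unfolding d_def by (rule count)
  have "(\<Sum>x\<in>UNIV. d x) = (\<Sum>j\<in>UNIV. \<Sum>x\<in>UNIV. of_bool (x \<in> range (\<lambda>i. c i j)))"
    unfolding d by (rule sum.swap)
  also have "\<dots> = (\<Sum>j\<in>(UNIV::'s set). 10)"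
    by (intro sum.cong refl) (simp only: count[symmetric] Collect_mem_eq card_column)
  finally have sum_d: "(\<Sum>x\<in>UNIV. d x) = 100" using cols by simp
  \<comment> \<open>The square of \<open>d x\<close> counts ordered pairs of columns both containing
    colour \<open>x\<close>.\<close>
  have "(\<Sum>x\<in>UNIV. d x ^ 2) = (\<Sum>x\<in>UNIV. \<Sum>j\<in>UNIV. \<Sum>l\<in>UNIV.
      of_bool (x \<in> range (\<lambda>i. c i j) \<inter> range (\<lambda>i. c i l)))"
    unfolding d power2_eq_square sum_product by (simp add: of_bool_conj)
  also have "\<dots> = (\<Sum>j\<in>UNIV. \<Sum>x\<in>UNIV. \<Sum>l\<in>UNIV.
      of_bool (x \<in> range (\<lambda>i. c i j) \<inter> range (\<lambda>i. c i l)))"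
    by (rule sum.swap)
  also have "\<dots> = (\<Sum>j\<in>UNIV. \<Sum>l\<in>UNIV. \<Sum>x\<in>UNIV.
      of_bool (x \<in> range (\<lambda>i. c i j) \<inter> range (\<lambda>i. c i l)))"
    by (intro sum.cong refl sum.swap)
  also have "\<dots> = (\<Sum>j\<in>UNIV. \<Sum>l\<in>UNIV. card (common j l))"
    unfolding card_common count[symmetric] by (simp add: Int_def)
  also have "\<dots> \<le> (\<Sum>j\<in>(UNIV::'s set). 52)" by (intro sum_mono sum_common_le)
  finally have sq_le: "(\<Sum>x\<in>UNIV. d x ^ 2) \<le> 520" using cols by simp
  have "real (\<Sum>x\<in>UNIV. d x) ^ 2 \<le> real (\<Sum>x\<in>UNIV. d x ^ 2) * real CARD('k)"
    using Cauchy_Schwarz_ineq_sum[of "\<lambda>x. real (d x)" "\<lambda>_. 1" UNIV] by simp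
  also have "\<dots> \<le> 520 * 16" using sq_le colors by (intro mult_mono) linarith+
  finally show False unfolding sum_d by simp
qed

end

section \<open>Integral unit vectors\<close>

text \<open>A nonzero integer coordinate already has square at least 1 and exhausts the
  norm.\<close>

lemma integer_unit_vector:
  fixes v :: "real ^ 'n::finite"
  assumes "norm v = 1" and int: "\<And>k. v $ k \<in> \<int>"
  shows "\<exists>k. sim v (axis k 1)"
proof -
  have v0: "v \<noteq> 0" using assms(1) by auto
  then obtain k where k: "v $ k \<noteq> 0" by (auto simp: vec_eq_iff)
  have one: "\<bar>v $ k\<bar> \<ge> 1" using int[of k] k by (auto elim!: Ints_cases)
  have s: "(\<Sum>i\<in>UNIV. (v $ i)\<^sup>2) = 1"
    using assms(1) by (simp add: norm_vec_def L2_set_def)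
  have "(v $ k)\<^sup>2 + (\<Sum>i\<in>UNIV - {k}. (v $ i)\<^sup>2) = 1"
    using s by (simp add: sum.remove[of UNIV k])
  moreover have "(v $ k)\<^sup>2 \<ge> 1" using one by (metis one_le_power power2_abs)
  moreover have nn: "(\<Sum>i\<in>UNIV - {k}. (v $ i)\<^sup>2) \<ge> 0" by (intro sum_nonneg) auto
  ultimately have "(v $ k)\<^sup>2 = 1" "(\<Sum>i\<in>UNIV - {k}. (v $ i)\<^sup>2) = 0" by linarith+
  hence "v $ k = 1 \<or> v $ k = -1" "\<And>i. i \<noteq> k \<Longrightarrow> v $ i = 0"
    by (auto simp: power2_eq_1_iff sum_nonneg_eq_0_iff)
  hence "sim v (axis k 1)" by (auto simp: sim_def vec_eq_iff axis_def)
  thus ?thesis ..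
qed

lemma integer_formula_basis:
  assumes "integer_formula g"
  shows "\<exists>k. sim (g (axis i 1) (axis j 1)) (axis k 1)"
proof (rule integer_unit_vector)
  show "norm (g (axis i 1) (axis j 1)) = 1"
    using assms by (simp add: integer_formula_def normed_bilinear_def)
  fix k
  obtain c :: "_ \<Rightarrow> _ \<Rightarrow> _ \<Rightarrow> int" where
    "\<And>x y k. g x y $ k = (\<Sum>i\<in>UNIV. \<Sum>j\<in>UNIV. of_int (c k i j) * x $ i * y $ j)"
    using assms by (auto simp: integer_formula_def integer_coeffs_def)
  thus "g (axis i 1) (axis j 1) $ k \<in> \<int>" by (auto simp: axis_def intro!: Ints_sum)
qed

section \<open>Clifford action of a square normed bilinear map\<close>

context
  fixes F :: "real ^ 'h::finite \<Rightarrow> real ^ 'm::finite \<Rightarrow> real ^ 'm"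
  assumes F: "normed_bilinear F"
begin

lemma linear_F: "linear (F x)" "linear (\<lambda>x. F x y)"
  using F by (auto simp: normed_bilinear_def bilinear_def)

lemma norm_F: "norm (F x y) = norm x * norm y"
  using F by (simp add: normed_bilinear_def)

lemma adjoint_F_F: "adjoint (F x) (F x y) = (norm x)\<^sup>2 *\<^sub>R y"
proof -
  have "F x y \<bullet> F x z = (norm x)\<^sup>2 * (y \<bullet> z)" for z
  proof -
    have e: "u \<bullet> v = ((norm (u + v))\<^sup>2 - (norm u)\<^sup>2 - (norm v)\<^sup>2) / 2" for u v :: "real ^ 'm"
      by (simp add: power2_norm_eq_inner inner_add inner_commute)
    show ?thesis
      unfolding e[of y] e[of "F x y"]
      by (simp add: linear_add[OF linear_F(1), symmetric] norm_F power_mult_distrib algebra_simps)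
  qed
  hence "z \<bullet> adjoint (F x) (F x y) = z \<bullet> ((norm x)\<^sup>2 *\<^sub>R y)" for z
    by (simp add: adjoint_works[OF linear_F(1)] inner_commute[of "F x z"] inner_commute[of z])
  thus ?thesis using vector_eq_ldot by blast
qed

text \<open>Here squareness enters: for nonzero \<open>x\<close> the injective map
  \<open>F x\<close> is onto, so the one-sided identity \<open>adjoint_F_F\<close> becomes
  two-sided.\<close>

lemma F_adjoint_F: "F x (adjoint (F x) z) = (norm x)\<^sup>2 *\<^sub>R z"
proof (cases "x = 0")
  case True
  thus ?thesis using linear_0[OF linear_F(2)] by simp
next
  case False
  have "inj (F x)"
    using False norm_F[of x] by (auto simp: linear_injective_0[OF linear_F(1)])
      (metis mult_eq_0_iff norm_eq_zero)
  hence "surj (F x)" by (rule linear_inj_imp_surj[OF linear_F(1)])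
  then obtain y where "z = F x y" by auto
  thus ?thesis by (simp add: adjoint_F_F linear_cmul[OF linear_F(1)])
qed

lemma adjoint_F_add: "adjoint (F (x + x')) z = adjoint (F x) z + adjoint (F x') z"
proof -
  have "u \<bullet> adjoint (F (x + x')) z = u \<bullet> (adjoint (F x) z + adjoint (F x') z)" for u
    by (simp add: adjoint_works[OF linear_F(1)] inner_add linear_add[OF linear_F(2)])
  thus ?thesis using vector_eq_ldot by blast
qed

text \<open>The symmetric block matrix with zero diagonal and off-diagonal blocks \<open>F x\<close>
  and its transpose.\<close>

definition swap_action :: "real ^ 'h \<Rightarrow> (real ^ 'm) \<times> (real ^ 'm) \<Rightarrow> (real ^ 'm) \<times> (real ^ 'm)"
  where "swap_action x p = (adjoint (F x) (snd p), F x (fst p))"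

lemma linear_swap_action: "linear (swap_action x)"
  unfolding swap_action_def
  by (rule linearI)
    (auto simp: linear_add[OF linear_F(1)] linear_cmul[OF linear_F(1)]
      linear_add[OF adjoint_linear[OF linear_F(1)]] linear_cmul[OF adjoint_linear[OF linear_F(1)]])

lemma swap_action_sq: "swap_action x (swap_action x p) = (norm x)\<^sup>2 *\<^sub>R p"
  by (simp add: swap_action_def adjoint_F_F F_adjoint_F prod_eq_iff)

lemma swap_action_add: "swap_action (x + x') p = swap_action x p + swap_action x' p"
  by (simp add: swap_action_def adjoint_F_add linear_add[OF linear_F(2)])

text \<open>Polarisation of \<open>swap_action_sq\<close> at \<open>x + x'\<close>, using
  Pythagoras.\<close>

lemma swap_action_anti:
  assumes "x \<bullet> x' = 0"
  shows "swap_action x (swap_action x' p) = - swap_action x' (swap_action x p)"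
proof -
  have "swap_action (x + x') (swap_action (x + x') p) =
      (norm x)\<^sup>2 *\<^sub>R p + (norm x')\<^sup>2 *\<^sub>R p +
      (swap_action x (swap_action x' p) + swap_action x' (swap_action x p))"
    by (simp add: swap_action_add linear_add[OF linear_swap_action] swap_action_sq)
  moreover have "(norm (x + x'))\<^sup>2 = (norm x)\<^sup>2 + (norm x')\<^sup>2"
    using assms by (simp add: power2_norm_eq_inner inner_add inner_commute)
  ultimately have "swap_action x (swap_action x' p) + swap_action x' (swap_action x p) = 0"
    by (simp add: swap_action_sq scaleR_add_left)
  thus ?thesis by (simp add: eq_neg_iff_add_eq_0)
qed

end

section \<open>From a restriction to a coloured action\<close>

theorem theorem1:
  fixes g :: "real ^ 10 \<Rightarrow> real ^ 10 \<Rightarrow> real ^ 16"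
    and F :: "real ^ 'h::finite \<Rightarrow> real ^ 'm::finite \<Rightarrow> real ^ 'm"
  assumes "integer_formula g"
    and "normed_bilinear F"
  shows "\<not> is_restriction g F"
proof
  assume "is_restriction g F"
  then obtain \<alpha> \<beta> \<gamma> where
    lin: "linear \<alpha>" "linear \<beta>" "linear \<gamma>"
    and iso: "\<And>x. norm (\<alpha> x) = norm x" "\<And>y. norm (\<beta> y) = norm y" "\<And>z. norm (\<gamma> z) = norm z"
    and comm: "\<And>x y. \<gamma> (g x y) = F (\<alpha> x) (\<beta> y)"
    unfolding is_restriction_def linear_isometry_onto_def by blast
  have reflect: "f u = f v \<Longrightarrow> u = v" if "linear f" "\<And>x. norm (f x) = norm x"
    for f :: "real ^ 'p \<Rightarrow> real ^ 'q" and u v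
  proof -
    assume "f u = f v"
    hence "f (u - v) = 0" by (simp add: linear_diff[OF that(1)])
    thus "u = v" using that(2)[of "u - v"] by simp
  qed
  have sim_iff: "sim (f u) (f v) \<longleftrightarrow> sim u v" if "linear f" "\<And>x. norm (f x) = norm x"
    for f :: "real ^ 'p \<Rightarrow> real ^ 'q" and u v
    using reflect[OF that] by (auto simp: sim_def linear_neg[OF that(1), symmetric])
  have axis_inj: "sim (axis i 1 :: real ^ 'p) (axis k 1) \<Longrightarrow> i = k" for i k :: "'p::finite"
    by (auto simp: sim_def vec_eq_iff axis_def split: if_splits)
  obtain c where c: "\<And>i j. sim (g (axis i 1) (axis j 1)) (axis (c i j) 1)"
    using integer_formula_basis[OF assms(1)] by metis
  define a where "a i = swap_action F (\<alpha> (axis i 1))" for i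
  \<comment> \<open>Placed in the first summand, columns are mapped by \<open>a i\<close> through
    \<open>F\<close> into the second.\<close>
  define w where "w j = (\<beta> (axis j 1), 0 :: real ^ 'm)" for j
  note S = assms(2)
  have orth: "\<alpha> (axis i 1) \<bullet> \<alpha> (axis k 1) = 0" if "i \<noteq> k" for i k
  proof -
    have "\<alpha> x \<bullet> \<alpha> y = x \<bullet> y" for x y
      using iso(1) lin(1) by (simp add: dot_norm linear_add[symmetric])
    thus ?thesis using that by (simp add: inner_axis_axis)
  qed
  have aw: "a i (w j) = (0, \<gamma> (g (axis i 1) (axis j 1)))" for i j
    by (simp add: a_def w_def swap_action_def[OF S] comm
        linear_0[OF adjoint_linear[OF linear_F(1)[OF S]]])
  have sim_pair: "sim (0 :: real ^ 'm, u) (0 :: real ^ 'm, v) \<longleftrightarrow> sim u v"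
    "sim (u, 0 :: real ^ 'm) (v, 0 :: real ^ 'm) \<longleftrightarrow> sim u v" for u v :: "real ^ 'm"
    by (auto simp: sim_def)
  interpret colored_action a w c
  proof (intro colored_action.intro anticommuting_involutions.intro colored_action_axioms.intro)
    show "linear (a i)" for i unfolding a_def by (rule linear_swap_action[OF S])
    show "a i (a i v) = v" for i v
      unfolding a_def by (simp add: swap_action_sq[OF S] iso)
    show "a i (a k v) = - a k (a i v)" if "i \<noteq> k" for i k v
      unfolding a_def by (rule swap_action_anti[OF S orth[OF that]])
    show "w j \<noteq> 0" for j
      using iso(2)[of "axis j 1"] by (auto simp: w_def zero_prod_def)
    show "j = l" if "sim (w j) (w l)" for j l
      using that by (auto simp: w_def sim_pair sim_iff[OF lin(2) iso(2)] dest: axis_inj)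
    show "c i j = c k l \<longleftrightarrow> sim (a i (w j)) (a k (w l))" for i j k l
      unfolding aw sim_pair sim_iff[OF lin(3) iso(3)]
    proof
      assume "c i j = c k l"
      with c[of i j] have "sim (g (axis i 1) (axis j 1)) (axis (c k l) 1)" by simp
      from sim_trans[OF this sim_sym[OF c]]
      show "sim (g (axis i 1) (axis j 1)) (g (axis k 1) (axis l 1))" .
    next
      assume "sim (g (axis i 1) (axis j 1)) (g (axis k 1) (axis l 1))"
      from sim_trans[OF sim_trans[OF sim_sym[OF c] this] c]
      show "c i j = c k l" by (rule axis_inj)
    qed
  qed simp_all
  show False by (rule contradiction)
qed

end
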